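(* The operator $H_L:(Lip(T,X),\|\cdot\|_{BL})\to(Lip(T,X),\|\cdot\|_{BL})$, defined by $H_L(f)(t)=\int_\Theta (R_\theta\circ f\circ\omega_\theta)(t)\,dW(\theta)$ for $f\in Lip(T,X)$ and $t\in T$, is linear and continuous, and its operator norm satisfies $$\|H_L\|_o\leq\int_\Theta\|R_\theta\|_o(1+r_\theta)\,dW(\theta).$$
   Context: $K$ is $\mathbb{R}$ or $\mathbb{C}$. $(\Theta,\Sigma,W)$ is a measure space, $(T,d)$ is a compact metric space with at least two elements, and $X$ is a non-null Hilbert space over $K$. For a topological space $Z$, $\mathcal{B}_Z$ denotes its Borel $\sigma$-algebra. $\omega:T\times\Theta\to T$ is $(\mathcal{B}_T\otimes\Sigma,\mathcal{B}_T)$-measurable and $R:X\times\Theta\to X$ is $(\mathcal{B}_X\otimes\Sigma,\mathcal{B}_X)$-measurable. For $\theta\in\Theta$ put $\omega_\theta(t)=\omega(t,\theta)$ and $R_\theta(x)=R(x,\theta)$. For every $\theta\in\Theta$: $R_\theta$ is a continuous linear operator on $X$, with operator norm $\|R_\theta\|_o$; and $\omega_\theta:T\to T$ is Lipschitz with (smallest) Lipschitz constant $r_\theta=\sup_{s\ne t} d(\omega_\theta(s),\omega_\theta(t))/d(s,t)<\infty$. The function $\theta\mapsto\|R_\theta\|_o$ is assumed $\Sigma$-measurable ($\theta\mapsto r_\theta$ is then automatically $\Sigma$-measurable), and it is assumed that $\int_\Theta\|R_\theta\|_o(1+r_\theta)\,dW(\theta)<\infty$. $Lip(T,X)$ is the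 vector space of Lipschitz functions $f:T\to X$, with $\|f\|_L=\sup_{s\neq t}\|f(s)-f(t)\|/d(s,t)$, $\|f\|_\infty=\sup_{t\in T}\|f(t)\|$, and norm $\|f\|_{BL}=\|f\|_\infty+\|f\|_L$. For every continuous $f:T\to X$ and $t\in T$ the function $\theta\mapsto (R_\theta\circ f\circ\omega_\theta)(t)$ is Bochner integrable with respect to $W$; the integral defining $H_L(f)(t)$ is a Bochner integral, and $H_L(f)$ is Lipschitz whenever $f$ is. *)

theory Defs
  imports "HOL-Analysis.Analysis"
begin

section \<open>The scalar field\<close>

text \<open>The fields \<open>\<real>\<close> and \<open>\<complex>\<close>: up to isometric isomorphism, the axioms leave no other possibility.
  Conjugation is inherited from \<open>\<complex>\<close> through the embedding.\<close>

class real_or_complex = real_normed_field +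
  fixes rc_embed :: "'a \<Rightarrow> complex"
  assumes rc_embed_add: "rc_embed (a + b) = rc_embed a + rc_embed b"
    and rc_embed_mult: "rc_embed (a * b) = rc_embed a * rc_embed b"
    and rc_embed_scaleR: "rc_embed (scaleR r 1) = of_real r"
    and norm_rc_embed: "norm (rc_embed a) = norm a"
    and range_rc_embed: "range rc_embed = \<real> \<or> range rc_embed = UNIV"

instantiation real :: real_or_complex
begin
definition "rc_embed = complex_of_real"
instance
  by standard (auto simp: rc_embed_real_def Reals_def)
end

instantiation complex :: real_or_complex
begin
definition "rc_embed = (\<lambda>z::complex. z)"
instance
  by standard (simp_all add: rc_embed_complex_def scaleR_conv_of_real)
end


section \<open>Hilbert spaces\<close>

text \<open>The type class \<open>banach\<close> supplies the norm, its topology, completeness and the underlying real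
  vector space; the locale adds the scalar multiplication by \<open>'k\<close>, compatible with the real one, and
  the inner product (linear in the first argument) that induces the norm.\<close>

locale hilbert_space = vector_space scale
  for scale :: "'k::real_or_complex \<Rightarrow> 'x::banach \<Rightarrow> 'x" +
  fixes ip :: "'x \<Rightarrow> 'x \<Rightarrow> 'k"
  assumes scale_of_real: "scale (of_real r) x = r *\<^sub>R x"
    and ip_add_left: "ip (x + y) z = ip x z + ip y z"
    and ip_scale_left: "ip (scale c x) z = c * ip x z"
    and ip_conj_sym: "rc_embed (ip y x) = cnj (rc_embed (ip x y))"
    and ip_self: "ip x x = of_real ((norm x)\<^sup>2)"


section \<open>The Bochner integral\<close>

text \<open>The library's \<open>has_bochner_integral\<close> is restricted by its type to second countable
  (hence separable) spaces. This is its definition without that restriction.\<close>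

definition has_bochner_integral_gen ::
    "'a measure \<Rightarrow> ('a \<Rightarrow> 'b::real_normed_vector) \<Rightarrow> 'b \<Rightarrow> bool" where
  "has_bochner_integral_gen M f x \<longleftrightarrow>
     f \<in> borel_measurable M \<and>
     (\<exists>s. (\<forall>i::nat. Bochner_Integration.simple_bochner_integrable M (s i)) \<and>
          (\<lambda>i. \<integral>\<^sup>+\<theta>. ennreal (norm (f \<theta> - s i \<theta>)) \<partial>M) \<longlonglongrightarrow> 0 \<and>
          (\<lambda>i. Bochner_Integration.simple_bochner_integral M (s i)) \<longlonglongrightarrow> x)"

definition bochner_integrable :: "'a measure \<Rightarrow> ('a \<Rightarrow> 'b::real_normed_vector) \<Rightarrow> bool" where
  "bochner_integrable M f \<longleftrightarrow> (\<exists>x. has_bochner_integral_gen M f x)"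

definition bochner_integral :: "'a measure \<Rightarrow> ('a \<Rightarrow> 'b::real_normed_vector) \<Rightarrow> 'b" where
  "bochner_integral M f = (THE x. has_bochner_integral_gen M f x)"

lemma has_bochner_integral_gen_eq:
  fixes x :: "'b::{real_normed_vector, second_countable_topology}"
  shows "has_bochner_integral_gen M f x \<longleftrightarrow> has_bochner_integral M f x"
  unfolding has_bochner_integral_gen_def has_bochner_integral.simps by auto

text \<open>The part of strong (Bochner) measurability that goes beyond Borel measurability. It is necessary for
  Bochner integrability, and it holds for every function with values in a separable space. For
  nonseparable targets it does not follow from Borel measurability: on a set carrying a diffuse
  probability defined on all subsets (a real-valued measurable cardinal \<open>\<kappa>\<close>), the map
  \<open>\<theta> \<mapsto> e\<^sub>\<theta>\<close> into \<open>\<ell>\<^sup>2(\<kappa>)\<close> is measurable and bounded but not almost everywhere separably valued.\<close>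

definition ae_separably_valued :: "'a measure \<Rightarrow> ('a \<Rightarrow> 'b::metric_space) \<Rightarrow> bool" where
  "ae_separably_valued M f \<longleftrightarrow> (\<exists>S. countable S \<and> (AE \<theta> in M. f \<theta> \<in> closure S))"

lemma ae_separably_valued_separable:
  assumes "countable S" and "closure S = (UNIV :: 'b::metric_space set)"
  shows "ae_separably_valued M (f :: 'a \<Rightarrow> 'b)"
  unfolding ae_separably_valued_def using assms by (intro exI[of _ S]) simp


lemma bochner_integrable_imp_ae_separably_valued:
  assumes "bochner_integrable M f"
  shows "ae_separably_valued M f"
proof -
  obtain s where f: "f \<in> borel_measurable M"
    and s: "\<And>i::nat. Bochner_Integration.simple_bochner_integrable M (s i)"
    and lim: "(\<lambda>i. \<integral>\<^sup>+\<theta>. ennreal (norm (f \<theta> - s i \<theta>)) \<partial>M) \<longlonglongrightarrow> 0"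
    using assms unfolding bochner_integrable_def has_bochner_integral_gen_def by auto
  define S where "S = insert 0 (\<Union>i. s i ` space M)"
  have "finite (s i ` space M)" for i
    using s[of i] by (auto simp: simple_function_def Bochner_Integration.simple_bochner_integrable.simps)
  then have "countable S"
    unfolding S_def by (auto intro: countable_finite)
  have "continuous_on UNIV (\<lambda>x. ennreal (infdist x S))"
    by (intro continuous_on_ennreal continuous_intros)
  then have meas: "(\<lambda>\<theta>. ennreal (infdist (f \<theta>) S)) \<in> borel_measurable M"
    using measurable_compose[OF f borel_measurable_continuous_onI] by simp
  have "(\<integral>\<^sup>+\<theta>. ennreal (infdist (f \<theta>) S) \<partial>M) \<le> (\<integral>\<^sup>+\<theta>. ennreal (norm (f \<theta> - s i \<theta>)) \<partial>M)" for i
    by (intro nn_integral_mono ennreal_leI, unfold dist_norm[symmetric], intro infdist_le)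
      (auto simp: S_def)
  then have "(\<integral>\<^sup>+\<theta>. ennreal (infdist (f \<theta>) S) \<partial>M) \<le> 0"
    using lim by (intro LIMSEQ_le_const) auto
  then have "AE \<theta> in M. ennreal (infdist (f \<theta>) S) = 0"
    using nn_integral_0_iff_AE[OF meas] by simp
  moreover have "x \<in> closure S" if "ennreal (infdist x S) = 0" for x
    using that in_closure_iff_infdist_zero[of S x] infdist_nonneg[of x S]
    by (auto simp: S_def ennreal_eq_0_iff)
  ultimately have "AE \<theta> in M. f \<theta> \<in> closure S" by auto
  with \<open>countable S\<close> show ?thesis unfolding ae_separably_valued_def by blast
qed


section \<open>Lipschitz functions\<close>

definition Lip :: "('t::metric_space \<Rightarrow> 'x::metric_space) set" where
  "Lip = {f. \<exists>L. L-lipschitz_on UNIV f}"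

text \<open>For vector-valued \<open>f\<close> this is the seminorm \<open>\<parallel>f\<parallel>\<^sub>L\<close>; for \<open>\<omega>\<^sub>\<theta>\<close> it is \<open>r\<^sub>\<theta>\<close>. As a supremum in \<open>real\<close> it
  is meaningful only for Lipschitz \<open>f\<close> on a space with at least two points.\<close>

definition lip_const :: "('t::metric_space \<Rightarrow> 'x::metric_space) \<Rightarrow> real" where
  "lip_const f = (SUP (s, t)\<in>{(s, t). s \<noteq> t}. dist (f s) (f t) / dist s t)"

definition sup_norm :: "('t \<Rightarrow> 'x::real_normed_vector) \<Rightarrow> real" where
  "sup_norm f = (SUP t. norm (f t))"

definition BL_norm :: "('t::metric_space \<Rightarrow> 'x::real_normed_vector) \<Rightarrow> real" where
  "BL_norm f = sup_norm f + lip_const f"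

text \<open>The locale \<open>Metric_space\<close> wants a distance that is symmetric and nonnegative also outside the carrier,
  hence the guard.\<close>

definition BL_dist :: "('t::metric_space \<Rightarrow> 'x::real_normed_vector) \<Rightarrow> ('t \<Rightarrow> 'x) \<Rightarrow> real" where
  "BL_dist f g = (if f \<in> Lip \<and> g \<in> Lip then BL_norm (\<lambda>t. f t - g t) else 0)"

definition BL_topology :: "('t::metric_space \<Rightarrow> 'x::real_normed_vector) topology" where
  "BL_topology = Metric_space.mtopology Lip BL_dist"

definition BL_onorm ::
    "(('t::metric_space \<Rightarrow> 'x::real_normed_vector) \<Rightarrow> ('t \<Rightarrow> 'x)) \<Rightarrow> real" where
  "BL_onorm H = (SUP f\<in>{f \<in> Lip. BL_norm f \<le> 1}. BL_norm (H f))"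

lemma Metric_space_BL_dist:
  assumes comp: "compact (UNIV :: 't::metric_space set)" and two: "\<exists>s t :: 't. s \<noteq> t"
  shows "Metric_space (Lip :: ('t \<Rightarrow> 'x::real_normed_vector) set) BL_dist"
proof -
  let ?P = "{(s :: 't, t). s \<noteq> t}"
  have ne: "?P \<noteq> {}" using two by auto
  have diff: "(\<lambda>t. f t - g t) \<in> Lip" if "f \<in> Lip" "g \<in> Lip" for f g :: "'t \<Rightarrow> 'x"
    using that unfolding Lip_def mem_Collect_eq
    by (metis lipschitz_on_diff)
  have bdd1: "bdd_above (range (\<lambda>t. norm (f t)))" if "f \<in> Lip" for f :: "'t \<Rightarrow> 'x"
  proof -
    have "continuous_on UNIV f"
      using that unfolding Lip_def mem_Collect_eq by (metis lipschitz_on_continuous_on)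
    then have "bounded (range f)"
      using comp compact_continuous_image compact_imp_bounded by blast
    then show ?thesis unfolding bounded_iff bdd_above_def by auto
  qed
  have bdd2: "bdd_above ((\<lambda>(s, t). dist (f s) (f t) / dist s t) ` ?P)"
    if "f \<in> Lip" for f :: "'t \<Rightarrow> 'x"
  proof -
    obtain L where "L-lipschitz_on UNIV f" using \<open>f \<in> Lip\<close> unfolding Lip_def by blast
    then show ?thesis
      unfolding lipschitz_on_def by (intro bdd_aboveI2[where M = L]) (auto simp: divide_le_eq)
  qed
  have up1: "norm (f t) \<le> sup_norm f" if "f \<in> Lip" for f :: "'t \<Rightarrow> 'x" and t
    unfolding sup_norm_def using bdd1[OF that] by (intro cSUP_upper) auto
  have up2: "dist (f s) (f t) / dist s t \<le> lip_const f" if "f \<in> Lip" "s \<noteq> t" for f :: "'t \<Rightarrow> 'x" and s t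
    unfolding lip_const_def using cSUP_upper[OF _ bdd2[OF that(1)], of "(s, t)"] that(2) by auto
  obtain s0 t0 :: 't where st0: "s0 \<noteq> t0" using two by auto
  have nn1: "0 \<le> sup_norm f" if "f \<in> Lip" for f :: "'t \<Rightarrow> 'x"
    using up1[OF that, of s0] norm_ge_zero order_trans by blast
  have nn2: "0 \<le> lip_const f" if "f \<in> Lip" for f :: "'t \<Rightarrow> 'x"
    using up2[OF that st0] by (meson divide_nonneg_nonneg order_trans zero_le_dist)
  have tri: "BL_norm (\<lambda>t. f t + g t) \<le> BL_norm f + BL_norm g"
    if "f \<in> Lip" "g \<in> Lip" for f g :: "'t \<Rightarrow> 'x"
  proof -
    have "sup_norm (\<lambda>t. f t + g t) \<le> sup_norm f + sup_norm g"
      by (subst sup_norm_def, intro cSUP_least UNIV_not_empty norm_triangle_le add_mono up1 that)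
    moreover have "lip_const (\<lambda>t. f t + g t) \<le> lip_const f + lip_const g"
    proof (subst lip_const_def, intro cSUP_least, rule ne, clarify)
      fix s t :: 't assume st: "s \<noteq> t"
      have "dist (f s + g s) (f t + g t) / dist s t
          \<le> (dist (f s) (f t) + dist (g s) (g t)) / dist s t"
        by (intro divide_right_mono dist_triangle_add) auto
      also have "\<dots> \<le> lip_const f + lip_const g"
        unfolding add_divide_distrib by (intro add_mono up2 that st)
      finally show "dist (f s + g s) (f t + g t) / dist s t \<le> lip_const f + lip_const g" .
    qed
    ultimately show ?thesis unfolding BL_norm_def by linarith
  qed
  have zero: "BL_dist f f = 0" for f :: "'t \<Rightarrow> 'x"
  proof -
    have "lip_const (\<lambda>t::'t. 0::'x) = 0"
      unfolding lip_const_def using ne by (simp add: split_def)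
    then show ?thesis by (simp add: BL_dist_def BL_norm_def sup_norm_def)
  qed
  show ?thesis
  proof unfold_locales
    fix f g :: "'t \<Rightarrow> 'x"
    have minus: "sup_norm (\<lambda>t. f t - g t) = sup_norm (\<lambda>t. g t - f t)"
      by (simp add: sup_norm_def norm_minus_commute)
    have minus': "lip_const (\<lambda>t. f t - g t) = lip_const (\<lambda>t. g t - f t)"
    proof -
      have "dist (f s - g s) (f t - g t) = dist (g s - f s) (g t - f t)" for s t
        using dist_minus[of "f s - g s" "f t - g t"] by simp
      then show ?thesis by (simp add: lip_const_def)
    qed
    show "BL_dist f g = BL_dist g f"
      by (simp add: BL_dist_def BL_norm_def minus minus')
  next
    fix f g :: "'t \<Rightarrow> 'x" assume "f \<in> Lip" "g \<in> Lip"
    note d = diff[OF this]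
    show "(BL_dist f g = 0) = (f = g)"
    proof
      assume "BL_dist f g = 0"
      then have "sup_norm (\<lambda>t. f t - g t) = 0"
        using nn1[OF d] nn2[OF d] \<open>f \<in> Lip\<close> \<open>g \<in> Lip\<close> by (simp add: BL_dist_def BL_norm_def)
      then have "norm (f t - g t) \<le> 0" for t using up1[OF d, of t] by simp
      then show "f = g" by auto
    qed (simp add: zero)
  next
    fix f g h :: "'t \<Rightarrow> 'x" assume "f \<in> Lip" "g \<in> Lip" "h \<in> Lip"
    then show "BL_dist f h \<le> BL_dist f g + BL_dist g h"
      using tri[of "\<lambda>t. f t - g t" "\<lambda>t. g t - h t"] diff by (simp add: BL_dist_def)
  next
    fix f g :: "'t \<Rightarrow> 'x"
    show "0 \<le> BL_dist f g"
      using nn1[OF diff] nn2[OF diff] by (simp add: BL_dist_def BL_norm_def)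
  qed
qed


section \<open>The operator \<open>H\<^sub>L\<close>\<close>

definition H_L :: "'th measure \<Rightarrow> ('x::real_normed_vector \<times> 'th \<Rightarrow> 'x) \<Rightarrow> ('t \<times> 'th \<Rightarrow> 't)
    \<Rightarrow> ('t \<Rightarrow> 'x) \<Rightarrow> 't \<Rightarrow> 'x" where
  "H_L W R \<omega> f t = bochner_integral W (\<lambda>\<theta>. R (f (\<omega> (t, \<theta>)), \<theta>))"

end

theory Submission
  imports Defs
begin

text \<open>Write \<open>\<rho> \<theta>\<close> for the operator norm of \<open>R\<^sub>\<theta>\<close> and \<open>r \<theta>\<close> for the Lipschitz constant of \<open>\<omega>\<^sub>\<theta>\<close>. Pointwise in \<open>\<theta>\<close>,
  the integrand defining \<open>H f\<close> satisfies

    \<^item> \<open>norm (R\<^sub>\<theta> (f (\<omega>\<^sub>\<theta> t))) \<le> \<rho> \<theta> * sup_norm f\<close>,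
    \<^item> \<open>norm (R\<^sub>\<theta> (f (\<omega>\<^sub>\<theta> s)) - R\<^sub>\<theta> (f (\<omega>\<^sub>\<theta> t))) \<le> \<rho> \<theta> * r \<theta> * lip_const f * dist s t\<close>.

  Integrating, with \<open>A = \<integral>\<rho>\<close> and \<open>B = \<integral>\<rho> * r\<close>, gives \<open>sup_norm (H f) \<le> A * sup_norm f\<close> and
  \<open>lip_const (H f) \<le> B * lip_const f\<close> (\<open>norm_H_le\<close>, \<open>dist_H_le\<close>). Hence
  \<open>BL_norm (H f) \<le> A * sup_norm f + B * lip_const f \<le> (A + B) * BL_norm f\<close>, and
  \<open>A + B = \<integral>\<rho> * (1 + r)\<close> is the bound claimed; continuity follows by linearity.

  The work lies in the integration theory, because \<open>X\<close> may be nonseparable. There a sum of two Borel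
  functions need not be Borel, so measurability is never inferred from vector arithmetic: for
  vector-valued integrands it comes from the joint measurability of \<open>R\<close> or from composition with a continuous
  map, and all estimates use real functions such as \<open>norm (f - s)\<close> with \<open>s\<close> simple. With this discipline one estimate,
  \<open>has_bochner_integral_gen_dist_le\<close>, yields uniqueness of the integral and both bounds above.
  Existence (\<open>bochner_integrableI_ae_separably_valued\<close>) needs almost separable values of
  \<open>\<theta> \<mapsto> R\<^sub>\<theta> (f (\<omega>\<^sub>\<theta> t))\<close>. These are inherited from those of \<open>\<theta> \<mapsto> R\<^sub>\<theta> x\<close>, since \<open>T\<close> is compact: countably many
  \<open>x\<close> are dense in the range of \<open>f\<close>, and \<open>R\<^sub>\<theta>\<close> is continuous.

  Finally, the bound is meaningful only if \<open>r\<close> is measurable; this holds because the supremum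
  defining \<open>r \<theta>\<close> may be taken over a countable dense set (\<open>lip_const_measurable\<close>).\<close>

section \<open>The Bochner integral without second countability\<close>

text \<open>Splitting the domain along the finitely many values \<open>y\<close> of \<open>s\<close> reduces the claim to
  \<open>norm (f \<theta> - y)\<close>, a continuous function of \<open>f \<theta>\<close>. The difference \<open>f - s\<close> is thus kept inside the norm,
  and no measurability of subtraction on \<open>'b \<times> 'b\<close> is involved.\<close>

lemma measurable_norm_diff_simple:
  fixes f s :: "'a \<Rightarrow> 'b::real_normed_vector"
  assumes f: "f \<in> borel_measurable M" and s: "simple_function M s"
  shows "(\<lambda>\<theta>. norm (f \<theta> - s \<theta>)) \<in> borel_measurable M"
proof (rule measurable_compose_countable'[where I = "s ` space M" and f = "\<lambda>y \<theta>. norm (f \<theta> - y)"])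
  show "(\<lambda>\<theta>. norm (f \<theta> - y)) \<in> borel_measurable M" for y
    by (rule measurable_compose[OF f]) (intro borel_measurable_continuous_onI continuous_intros)
  show "s \<in> M \<rightarrow>\<^sub>M count_space (s ` space M)"
    using s by (auto simp: simple_function_def measurable_count_space_eq2)
  show "countable (s ` space M)"
    using s by (auto simp: simple_function_def intro: countable_finite)
qed

text \<open>Stability of the integral under approximation: \<open>s\<close> is meant to be close to \<open>f\<close>, and \<open>t\<close> to \<open>g\<close>. The
  function \<open>h\<close> stands in for \<open>norm (f - g)\<close>, which may fail to be measurable; without a measurable
  majorant the nonnegative integral need not be subadditive.\<close>

lemma simple_bochner_integral_dist_le:
  fixes f g s t :: "'a \<Rightarrow> 'b::real_normed_vector"
  assumes f: "f \<in> borel_measurable M" and g: "g \<in> borel_measurable M"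
    and s: "Bochner_Integration.simple_bochner_integrable M s"
    and t: "Bochner_Integration.simple_bochner_integrable M t"
    and h: "h \<in> borel_measurable M"
    and le: "\<And>\<theta>. \<theta> \<in> space M \<Longrightarrow> ennreal (norm (f \<theta> - g \<theta>)) \<le> h \<theta>"
  shows "ennreal (norm (Bochner_Integration.simple_bochner_integral M s
            - Bochner_Integration.simple_bochner_integral M t))
      \<le> (\<integral>\<^sup>+\<theta>. norm (f \<theta> - s \<theta>) \<partial>M) + (\<integral>\<^sup>+\<theta>. h \<theta> \<partial>M) + (\<integral>\<^sup>+\<theta>. norm (g \<theta> - t \<theta>) \<partial>M)"
    (is "ennreal (norm (?s - ?t)) \<le> _")
proof -
  have [measurable]: "(\<lambda>\<theta>. norm (f \<theta> - s \<theta>)) \<in> borel_measurable M"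
    "(\<lambda>\<theta>. norm (g \<theta> - t \<theta>)) \<in> borel_measurable M"
    using s t by (auto intro!: measurable_norm_diff_simple f g elim: simple_bochner_integrable.cases)
  note h[measurable]
  have "norm (?s - ?t) = norm (Bochner_Integration.simple_bochner_integral M (\<lambda>\<theta>. s \<theta> - t \<theta>))"
    using s t by (simp add: simple_bochner_integral_diff)
  also have "\<dots> \<le> Bochner_Integration.simple_bochner_integral M (\<lambda>\<theta>. norm (s \<theta> - t \<theta>))"
    using simple_bochner_integrable_compose2[of "(-)" M s t] s t
    by (auto intro!: simple_bochner_integral_norm_bound)
  finally have "ennreal (norm (?s - ?t))
      \<le> ennreal (Bochner_Integration.simple_bochner_integral M (\<lambda>\<theta>. norm (s \<theta> - t \<theta>)))"
    by (rule ennreal_leI)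
  also have "\<dots> = (\<integral>\<^sup>+\<theta>. norm (s \<theta> - t \<theta>) \<partial>M)"
    using simple_bochner_integrable_compose2[of "\<lambda>x y. norm (x - y)" M s t] s t
    by (auto intro!: simple_bochner_integral_eq_nn_integral)
  also have "\<dots> \<le> (\<integral>\<^sup>+\<theta>. (ennreal (norm (f \<theta> - s \<theta>)) + h \<theta>) + ennreal (norm (g \<theta> - t \<theta>)) \<partial>M)"
  proof (rule nn_integral_mono)
    fix \<theta> assume "\<theta> \<in> space M"
    have "norm (s \<theta> - t \<theta>) \<le> norm (f \<theta> - s \<theta>) + norm (f \<theta> - g \<theta>) + norm (g \<theta> - t \<theta>)"
      using norm_triangle_ineq[of "(s \<theta> - f \<theta>) + (f \<theta> - g \<theta>)" "g \<theta> - t \<theta>"]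
        norm_triangle_ineq[of "s \<theta> - f \<theta>" "f \<theta> - g \<theta>"]
      by (simp add: norm_minus_commute)
    then have "ennreal (norm (s \<theta> - t \<theta>))
        \<le> ennreal (norm (f \<theta> - s \<theta>)) + ennreal (norm (f \<theta> - g \<theta>)) + ennreal (norm (g \<theta> - t \<theta>))"
      by (metis ennreal_leI ennreal_plus norm_ge_zero add_nonneg_nonneg)
    also have "\<dots> \<le> ennreal (norm (f \<theta> - s \<theta>)) + h \<theta> + ennreal (norm (g \<theta> - t \<theta>))"
      using le[OF \<open>\<theta> \<in> space M\<close>] by (intro add_mono order_refl)
    finally show "ennreal (norm (s \<theta> - t \<theta>))
      \<le> (ennreal (norm (f \<theta> - s \<theta>)) + h \<theta>) + ennreal (norm (g \<theta> - t \<theta>))" .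
  qed
  also have "\<dots> = (\<integral>\<^sup>+\<theta>. norm (f \<theta> - s \<theta>) \<partial>M) + (\<integral>\<^sup>+\<theta>. h \<theta> \<partial>M) + (\<integral>\<^sup>+\<theta>. norm (g \<theta> - t \<theta>) \<partial>M)"
    by (simp add: nn_integral_add)
  finally show ?thesis .
qed

lemma has_bochner_integral_gen_dist_le_nn:
  assumes x: "has_bochner_integral_gen M f x" and y: "has_bochner_integral_gen M g y"
    and h: "h \<in> borel_measurable M"
    and le: "\<And>\<theta>. \<theta> \<in> space M \<Longrightarrow> ennreal (norm (f \<theta> - g \<theta>)) \<le> h \<theta>"
  shows "ennreal (norm (x - y)) \<le> (\<integral>\<^sup>+\<theta>. h \<theta> \<partial>M)"
proof -
  obtain s t where f: "f \<in> borel_measurable M" and g: "g \<in> borel_measurable M"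
    and s: "\<And>i::nat. Bochner_Integration.simple_bochner_integrable M (s i)"
    and t: "\<And>i::nat. Bochner_Integration.simple_bochner_integrable M (t i)"
    and s0: "(\<lambda>i. \<integral>\<^sup>+\<theta>. ennreal (norm (f \<theta> - s i \<theta>)) \<partial>M) \<longlonglongrightarrow> 0"
    and t0: "(\<lambda>i. \<integral>\<^sup>+\<theta>. ennreal (norm (g \<theta> - t i \<theta>)) \<partial>M) \<longlonglongrightarrow> 0"
    and sx: "(\<lambda>i. Bochner_Integration.simple_bochner_integral M (s i)) \<longlonglongrightarrow> x"
    and ty: "(\<lambda>i. Bochner_Integration.simple_bochner_integral M (t i)) \<longlonglongrightarrow> y"
    using x y unfolding has_bochner_integral_gen_def by blast
  have "(\<lambda>i. (\<integral>\<^sup>+\<theta>. norm (f \<theta> - s i \<theta>) \<partial>M) + (\<integral>\<^sup>+\<theta>. h \<theta> \<partial>M) + (\<integral>\<^sup>+\<theta>. norm (g \<theta> - t i \<theta>) \<partial>M))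
      \<longlonglongrightarrow> 0 + (\<integral>\<^sup>+\<theta>. h \<theta> \<partial>M) + 0"
    by (intro tendsto_add s0 t0 tendsto_const)
  moreover have "(\<lambda>i. ennreal (norm (Bochner_Integration.simple_bochner_integral M (s i)
      - Bochner_Integration.simple_bochner_integral M (t i)))) \<longlonglongrightarrow> ennreal (norm (x - y))"
    by (intro tendsto_ennrealI tendsto_norm tendsto_diff sx ty)
  ultimately show ?thesis
    using simple_bochner_integral_dist_le[OF f g s t h le] by (auto intro: LIMSEQ_le)
qed

text \<open>The basic estimate. It contains uniqueness (\<open>f = g\<close>, \<open>h = 0\<close>), the norm bound for an integral
  (\<open>g = 0\<close>), and the Lipschitz bound for an integral depending on a parameter.\<close>

lemma has_bochner_integral_gen_dist_le:
  fixes h :: "'a \<Rightarrow> real"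
  assumes x: "has_bochner_integral_gen M f x" and y: "has_bochner_integral_gen M g y"
    and h: "integrable M h"
    and le: "\<And>\<theta>. \<theta> \<in> space M \<Longrightarrow> norm (f \<theta> - g \<theta>) \<le> h \<theta>"
  shows "norm (x - y) \<le> (\<integral>\<theta>. h \<theta> \<partial>M)"
proof -
  have h0: "AE \<theta> in M. 0 \<le> h \<theta>"
    using le by (intro AE_I2) (meson norm_ge_zero order_trans)
  have "ennreal (norm (x - y)) \<le> (\<integral>\<^sup>+\<theta>. ennreal (h \<theta>) \<partial>M)"
    using h by (intro has_bochner_integral_gen_dist_le_nn[OF x y]) (auto intro: ennreal_leI le)
  also have "\<dots> = ennreal (\<integral>\<theta>. h \<theta> \<partial>M)"
    using h h0 by (rule nn_integral_eq_integral)
  finally show ?thesis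
    using integral_nonneg_AE[OF h0] by (simp add: ennreal_le_iff)
qed

lemma has_bochner_integral_gen_unique:
  assumes "has_bochner_integral_gen M f x" "has_bochner_integral_gen M f y"
  shows "x = y"
  using has_bochner_integral_gen_dist_le[OF assms, of "\<lambda>_. 0"] by simp

lemma bochner_integral_eqI:
  "has_bochner_integral_gen M f x \<Longrightarrow> bochner_integral M f = x"
  unfolding bochner_integral_def by (blast intro: has_bochner_integral_gen_unique)

lemma has_bochner_integral_gen_bochner_integral:
  "bochner_integrable M f \<Longrightarrow> has_bochner_integral_gen M f (bochner_integral M f)"
  unfolding bochner_integrable_def using bochner_integral_eqI by metis

lemma has_bochner_integral_gen_zero:
  "has_bochner_integral_gen M (\<lambda>_. 0) (0 :: 'b::real_normed_vector)"
proof -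
  have "Bochner_Integration.simple_bochner_integral M (\<lambda>_. 0) = (0 :: 'b::real_normed_vector)"
    by (auto simp: Bochner_Integration.simple_bochner_integral_def intro: sum.neutral)
  then show ?thesis
    unfolding has_bochner_integral_gen_def
    by (intro conjI exI[of _ "\<lambda>_ _. 0"]) (auto simp: simple_bochner_integrable.simps)
qed

lemma has_bochner_integral_gen_cong:
  assumes "\<And>\<theta>. \<theta> \<in> space M \<Longrightarrow> f \<theta> = g \<theta>"
  shows "has_bochner_integral_gen M f x \<longleftrightarrow> has_bochner_integral_gen M g x"
  unfolding has_bochner_integral_gen_def
  using assms by (simp cong: measurable_cong_simp nn_integral_cong_simp)

lemma ennreal_tendsto_zero_mono:
  fixes u v :: "nat \<Rightarrow> ennreal"
  assumes "\<And>i. u i \<le> v i" and "v \<longlonglongrightarrow> 0"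
  shows "u \<longlonglongrightarrow> 0"
  by (rule tendsto_sandwich[where f = "\<lambda>_. 0" and h = v]) (use assms in auto)

text \<open>Measurability of the sum is a hypothesis, since in a nonseparable space it does not follow from that
  of the summands.\<close>

lemma has_bochner_integral_gen_add:
  assumes x: "has_bochner_integral_gen M f x" and y: "has_bochner_integral_gen M g y"
    and meas: "(\<lambda>\<theta>. f \<theta> + g \<theta>) \<in> borel_measurable M"
  shows "has_bochner_integral_gen M (\<lambda>\<theta>. f \<theta> + g \<theta>) (x + y)"
proof -
  obtain s t where f: "f \<in> borel_measurable M" and g: "g \<in> borel_measurable M"
    and s: "\<And>i::nat. Bochner_Integration.simple_bochner_integrable M (s i)"
    and t: "\<And>i::nat. Bochner_Integration.simple_bochner_integrable M (t i)"
    and s0: "(\<lambda>i. \<integral>\<^sup>+\<theta>. ennreal (norm (f \<theta> - s i \<theta>)) \<partial>M) \<longlonglongrightarrow> 0"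
    and t0: "(\<lambda>i. \<integral>\<^sup>+\<theta>. ennreal (norm (g \<theta> - t i \<theta>)) \<partial>M) \<longlonglongrightarrow> 0"
    and sx: "(\<lambda>i. Bochner_Integration.simple_bochner_integral M (s i)) \<longlonglongrightarrow> x"
    and ty: "(\<lambda>i. Bochner_Integration.simple_bochner_integral M (t i)) \<longlonglongrightarrow> y"
    using x y unfolding has_bochner_integral_gen_def by blast
  have [measurable]: "(\<lambda>\<theta>. norm (f \<theta> - s i \<theta>)) \<in> borel_measurable M"
    "(\<lambda>\<theta>. norm (g \<theta> - t i \<theta>)) \<in> borel_measurable M" for i
    using s[of i] t[of i] f g
    by (auto intro!: measurable_norm_diff_simple elim: simple_bochner_integrable.cases)
  have "(\<integral>\<^sup>+\<theta>. norm (f \<theta> + g \<theta> - (s i \<theta> + t i \<theta>)) \<partial>M)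
      \<le> (\<integral>\<^sup>+\<theta>. norm (f \<theta> - s i \<theta>) \<partial>M) + (\<integral>\<^sup>+\<theta>. norm (g \<theta> - t i \<theta>) \<partial>M)" for i
  proof -
    have "(\<integral>\<^sup>+\<theta>. norm (f \<theta> + g \<theta> - (s i \<theta> + t i \<theta>)) \<partial>M)
        \<le> (\<integral>\<^sup>+\<theta>. ennreal (norm (f \<theta> - s i \<theta>)) + ennreal (norm (g \<theta> - t i \<theta>)) \<partial>M)"
      by (intro nn_integral_mono)
        (simp add: norm_diff_triangle_ineq flip: ennreal_plus)
    then show ?thesis by (simp add: nn_integral_add)
  qed
  moreover have "(\<lambda>i. (\<integral>\<^sup>+\<theta>. norm (f \<theta> - s i \<theta>) \<partial>M) + (\<integral>\<^sup>+\<theta>. norm (g \<theta> - t i \<theta>) \<partial>M)) \<longlonglongrightarrow> 0"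
    using tendsto_add[OF s0 t0] by simp
  ultimately have "(\<lambda>i. \<integral>\<^sup>+\<theta>. norm (f \<theta> + g \<theta> - (s i \<theta> + t i \<theta>)) \<partial>M) \<longlonglongrightarrow> 0"
    by (rule ennreal_tendsto_zero_mono)
  moreover have "(\<lambda>i. Bochner_Integration.simple_bochner_integral M (\<lambda>\<theta>. s i \<theta> + t i \<theta>)) \<longlonglongrightarrow> x + y"
    using tendsto_add[OF sx ty] s t by (simp add: simple_bochner_integral_add)
  moreover have "Bochner_Integration.simple_bochner_integrable M (\<lambda>\<theta>. s i \<theta> + t i \<theta>)" for i
    using simple_bochner_integrable_compose2[of "(+)", OF _ s t] by simp
  ultimately show ?thesis
    unfolding has_bochner_integral_gen_def using meas
    by (intro conjI exI[of _ "\<lambda>i \<theta>. s i \<theta> + t i \<theta>"]) auto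
qed

lemma has_bochner_integral_gen_bounded_linear:
  assumes x: "has_bochner_integral_gen M f x" and T: "bounded_linear T"
  shows "has_bochner_integral_gen M (\<lambda>\<theta>. T (f \<theta>)) (T x)"
proof -
  interpret T: bounded_linear T by fact
  obtain s where f: "f \<in> borel_measurable M"
    and s: "\<And>i::nat. Bochner_Integration.simple_bochner_integrable M (s i)"
    and s0: "(\<lambda>i. \<integral>\<^sup>+\<theta>. ennreal (norm (f \<theta> - s i \<theta>)) \<partial>M) \<longlonglongrightarrow> 0"
    and sx: "(\<lambda>i. Bochner_Integration.simple_bochner_integral M (s i)) \<longlonglongrightarrow> x"
    using x unfolding has_bochner_integral_gen_def by blast
  have [measurable]: "(\<lambda>\<theta>. norm (f \<theta> - s i \<theta>)) \<in> borel_measurable M" for i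
    using s[of i] f by (auto intro!: measurable_norm_diff_simple elim: simple_bochner_integrable.cases)
  obtain K where K: "K > 0" "\<And>x. norm (T x) \<le> norm x * K"
    using T.pos_bounded by blast
  have "(\<integral>\<^sup>+\<theta>. norm (T (f \<theta>) - T (s i \<theta>)) \<partial>M) \<le> ennreal K * (\<integral>\<^sup>+\<theta>. norm (f \<theta> - s i \<theta>) \<partial>M)" for i
  proof -
    have "(\<integral>\<^sup>+\<theta>. norm (T (f \<theta>) - T (s i \<theta>)) \<partial>M) \<le> (\<integral>\<^sup>+\<theta>. ennreal K * ennreal (norm (f \<theta> - s i \<theta>)) \<partial>M)"
      using K by (intro nn_integral_mono)
        (auto simp: mult.commute simp flip: T.diff ennreal_mult' intro!: ennreal_leI)
    then show ?thesis by (simp add: nn_integral_cmult)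
  qed
  moreover have "(\<lambda>i. ennreal K * (\<integral>\<^sup>+\<theta>. norm (f \<theta> - s i \<theta>) \<partial>M)) \<longlonglongrightarrow> 0"
    using ennreal_tendsto_cmult[OF _ s0, of "ennreal K"] by simp
  ultimately have "(\<lambda>i. \<integral>\<^sup>+\<theta>. norm (T (f \<theta>) - T (s i \<theta>)) \<partial>M) \<longlonglongrightarrow> 0"
    by (rule ennreal_tendsto_zero_mono)
  moreover have "(\<lambda>i. Bochner_Integration.simple_bochner_integral M (\<lambda>\<theta>. T (s i \<theta>))) \<longlonglongrightarrow> T x"
    using T.tendsto[OF sx] s by (simp add: simple_bochner_integral_linear T.linear_axioms)
  moreover have "(\<lambda>\<theta>. T (f \<theta>)) \<in> borel_measurable M"
    using f by (rule measurable_compose)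
      (intro borel_measurable_continuous_onI T.continuous_on continuous_on_id)
  moreover have "Bochner_Integration.simple_bochner_integrable M (\<lambda>\<theta>. T (s i \<theta>))" for i
    using simple_bochner_integrable_compose2[of "\<lambda>x y. T x", OF _ s s] by (simp add: T.zero)
  ultimately show ?thesis
    unfolding has_bochner_integral_gen_def
    by (intro conjI exI[of _ "\<lambda>i \<theta>. T (s i \<theta>)"]) auto
qed

text \<open>Enumerate a countable set \<open>e 0, e 1, \<dots>\<close> whose closure contains almost all values of \<open>f\<close>. The
  approximants start at \<open>0\<close> and move at step \<open>i\<close> to \<open>e i\<close> exactly where this is strictly closer to \<open>f \<theta>\<close>.
  The distance to \<open>f \<theta>\<close> therefore decreases; starting from \<open>0\<close> it never exceeds \<open>norm (f \<theta>)\<close>, the majorant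
  for dominated convergence.\<close>

lemma ae_separably_valued_simple_approximation:
  fixes f :: "'a \<Rightarrow> 'b::real_normed_vector"
  assumes f: "f \<in> borel_measurable M" and sep: "ae_separably_valued M f"
  obtains s where "\<And>i::nat. simple_function M (s i)"
    and "\<And>i \<theta>. norm (f \<theta> - s i \<theta>) \<le> norm (f \<theta>)"
    and "AE \<theta> in M. (\<lambda>i. norm (f \<theta> - s i \<theta>)) \<longlonglongrightarrow> 0"
proof -
  obtain S where S: "countable S" "AE \<theta> in M. f \<theta> \<in> closure S"
    using sep unfolding ae_separably_valued_def by blast
  \<comment> \<open>inserting \<open>0\<close> only secures nonemptiness, so that the enumeration stays inside the set\<close>
  define e where "e = from_nat_into (insert 0 S)"
  have S_e: "S \<subseteq> range e"
    using S(1) range_from_nat_into[of "insert 0 S"] by (auto simp: e_def)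
  define s where "s = rec_nat (\<lambda>_. 0)
    (\<lambda>i u \<theta>. if norm (f \<theta> - e i) < norm (f \<theta> - u \<theta>) then e i else u \<theta>)"
  have s0: "s 0 = (\<lambda>_. 0)" and s_Suc: "s (Suc i) =
      (\<lambda>\<theta>. if norm (f \<theta> - e i) < norm (f \<theta> - s i \<theta>) then e i else s i \<theta>)" for i
    unfolding s_def by (simp_all only: nat.rec)
  have dist_Suc: "norm (f \<theta> - s (Suc i) \<theta>) = min (norm (f \<theta> - e i)) (norm (f \<theta> - s i \<theta>))" for i \<theta>
    by (simp add: s_Suc)
  have simple: "simple_function M (s i)" for i
  proof (induction i)
    case 0
    then show ?case by (simp add: s0)
  next
    case (Suc i)
    have [measurable]: "(\<lambda>\<theta>. norm (f \<theta> - s i \<theta>)) \<in> borel_measurable M"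
      "(\<lambda>\<theta>. norm (f \<theta> - e i)) \<in> borel_measurable M"
      using f Suc measurable_norm_diff_simple[OF f, of "\<lambda>_. e i"]
      by (auto intro: measurable_norm_diff_simple)
    show ?case
      unfolding s_Suc by (intro simple_function_If Suc simple_function_const) measurable
  qed
  have dec: "decseq (\<lambda>i. norm (f \<theta> - s i \<theta>))" for \<theta>
    by (intro decseq_SucI) (simp only: dist_Suc min.cobounded2)
  have "norm (f \<theta> - s i \<theta>) \<le> norm (f \<theta>)" for i \<theta>
    using decseqD[OF dec, of 0 i] by (simp add: s0)
  moreover have "AE \<theta> in M. (\<lambda>i. norm (f \<theta> - s i \<theta>)) \<longlonglongrightarrow> 0"
    using S(2)
  proof eventually_elim
    case (elim \<theta>)
    show ?case
    proof (rule LIMSEQ_I)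
      fix r :: real assume "0 < r"
      then obtain y where "y \<in> S" "dist y (f \<theta>) < r"
        using elim closure_approachable by blast
      then obtain n where n: "norm (f \<theta> - e n) < r"
        using S_e by (auto simp: dist_norm norm_minus_commute)
      have "norm (f \<theta> - s i \<theta>) < r" if "Suc n \<le> i" for i
        using decseqD[OF dec that, of \<theta>] n dist_Suc[of \<theta> n] by simp
      then show "\<exists>no. \<forall>i\<ge>no. norm (norm (f \<theta> - s i \<theta>) - 0) < r" by auto
    qed
  qed
  ultimately show ?thesis using that simple by blast
qed

text \<open>The simple approximants converge to \<open>f\<close> in mean by dominated convergence, so their
  integrals form a Cauchy sequence.\<close>

proposition bochner_integrableI_ae_separably_valued:
  fixes f :: "'a \<Rightarrow> 'b::banach"
  assumes f: "f \<in> borel_measurable M" and sep: "ae_separably_valued M f"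
    and fin: "(\<integral>\<^sup>+\<theta>. ennreal (norm (f \<theta>)) \<partial>M) < \<infinity>"
  shows "bochner_integrable M f"
proof -
  obtain s where simple: "\<And>i::nat. simple_function M (s i)"
    and bound: "\<And>i \<theta>. norm (f \<theta> - s i \<theta>) \<le> norm (f \<theta>)"
    and lim: "AE \<theta> in M. (\<lambda>i. norm (f \<theta> - s i \<theta>)) \<longlonglongrightarrow> 0"
    using ae_separably_valued_simple_approximation[OF f sep] by blast
  note [measurable] = measurable_norm_diff_simple[OF f simple]
    measurable_compose[OF f borel_measurable_norm]
  have "norm (s i \<theta>) \<le> 2 * norm (f \<theta>)" for i \<theta>
    using bound[where i = i and \<theta> = \<theta>] norm_triangle_ineq3[of "f \<theta>" "f \<theta> - s i \<theta>"]
      norm_triangle_sub[of "s i \<theta>" "f \<theta>"] by (simp add: norm_minus_commute)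
  then have "(\<integral>\<^sup>+\<theta>. norm (s i \<theta>) \<partial>M) \<le> (\<integral>\<^sup>+\<theta>. 2 * ennreal (norm (f \<theta>)) \<partial>M)" for i
    by (intro nn_integral_mono) (metis ennreal_leI ennreal_mult' ennreal_numeral norm_ge_zero zero_le_numeral)
  also have "(\<integral>\<^sup>+\<theta>. 2 * ennreal (norm (f \<theta>)) \<partial>M) < \<infinity>"
    using fin by (simp add: nn_integral_cmult ennreal_mult_less_top)
  finally have s: "Bochner_Integration.simple_bochner_integrable M (s i)" for i
    using simple by (intro simple_bochner_integrableI_bounded) auto
  have L1: "(\<lambda>i. \<integral>\<^sup>+\<theta>. ennreal (norm (f \<theta> - s i \<theta>)) \<partial>M) \<longlonglongrightarrow> 0"
    using nn_integral_dominated_convergence_norm[where M = M and w = "\<lambda>\<theta>. norm (f \<theta>)" and u' = "\<lambda>_. 0::real"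
        and u = "\<lambda>i \<theta>. norm (f \<theta> - s i \<theta>)"] fin lim bound by simp
  have "Cauchy (\<lambda>i. Bochner_Integration.simple_bochner_integral M (s i))"
  proof (rule metric_CauchyI)
    fix r :: real assume "0 < r"
    then have "eventually (\<lambda>i. (\<integral>\<^sup>+\<theta>. ennreal (norm (f \<theta> - s i \<theta>)) \<partial>M) < ennreal (r / 2)) sequentially"
      using order_tendstoD(2)[OF L1, of "ennreal (r / 2)"] by simp
    then obtain n where n: "\<And>i. n \<le> i \<Longrightarrow> (\<integral>\<^sup>+\<theta>. ennreal (norm (f \<theta> - s i \<theta>)) \<partial>M) < ennreal (r / 2)"
      by (auto simp: eventually_sequentially)
    show "\<exists>n. \<forall>i\<ge>n. \<forall>j\<ge>n. dist (Bochner_Integration.simple_bochner_integral M (s i))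
        (Bochner_Integration.simple_bochner_integral M (s j)) < r"
    proof (intro exI[of _ n] allI impI)
      fix i j assume ij: "n \<le> i" "n \<le> j"
      have "ennreal (dist (Bochner_Integration.simple_bochner_integral M (s i))
          (Bochner_Integration.simple_bochner_integral M (s j)))
        \<le> (\<integral>\<^sup>+\<theta>. norm (f \<theta> - s i \<theta>) \<partial>M) + (\<integral>\<^sup>+\<theta>. norm (f \<theta> - s j \<theta>) \<partial>M)"
        using simple_bochner_integral_dist_le[OF f f s s, of "\<lambda>_. 0"] by (simp add: dist_norm)
      also have "\<dots> < ennreal (r / 2) + ennreal (r / 2)"
        using n ij by (intro add_strict_mono) auto
      also have "\<dots> = ennreal r" using \<open>0 < r\<close> by (simp flip: ennreal_plus)
      finally show "dist (Bochner_Integration.simple_bochner_integral M (s i))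
          (Bochner_Integration.simple_bochner_integral M (s j)) < r"
        by (simp add: ennreal_less_iff)
    qed
  qed
  then obtain x where "(\<lambda>i. Bochner_Integration.simple_bochner_integral M (s i)) \<longlonglongrightarrow> x"
    using convergent_eq_Cauchy by blast
  then show ?thesis
    unfolding bochner_integrable_def has_bochner_integral_gen_def using f s L1 by blast
qed


section \<open>Lipschitz functions on a compact space\<close>

lemma compact_UNIV_countable_dense:
  assumes "compact (UNIV :: 't::metric_space set)"
  obtains D :: "'t::metric_space set" where "countable D" "closure D = UNIV"
proof -
  have "\<exists>k. finite k \<and> (UNIV :: 't set) \<subseteq> (\<Union>x\<in>k. ball x (1 / Suc n))" for n
    using seq_compact_imp_totally_bounded[of "UNIV :: 't set"] assms
    by (auto simp: compact_eq_seq_compact_metric)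
  then obtain k where k: "\<And>n. finite (k n)" "\<And>n. (UNIV :: 't set) \<subseteq> (\<Union>x\<in>k n. ball x (1 / Suc n))"
    by metis
  have "t \<in> closure (\<Union>n. k n)" for t
    unfolding closure_approachable
  proof (intro allI impI)
    fix e :: real assume "0 < e"
    then obtain n where n: "1 / Suc n < e" using nat_approx_posE by blast
    obtain x where "x \<in> k n" "dist x t < 1 / Suc n" using k(2)[of n] unfolding subset_iff mem_ball UN_iff by blast
    then show "\<exists>y\<in>\<Union>n. k n. dist y t < e" using n by (meson UN_I UNIV_I order_less_trans)
  qed
  then show ?thesis
    using k(1) by (intro that[of "\<Union>n. k n"]) (auto intro: countable_finite)
qed

lemma Lip_continuous_on:
  fixes f :: "'t::metric_space \<Rightarrow> 'x::metric_space"
  shows "f \<in> Lip \<Longrightarrow> continuous_on UNIV f"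
  unfolding Lip_def mem_Collect_eq by (metis lipschitz_on_continuous_on)

lemma Lip_diff:
  fixes f g :: "'t::metric_space \<Rightarrow> 'x::real_normed_vector"
  shows "f \<in> Lip \<Longrightarrow> g \<in> Lip \<Longrightarrow> (\<lambda>t. f t - g t) \<in> Lip"
  unfolding Lip_def mem_Collect_eq by (metis lipschitz_on_diff)

lemma LipI:
  fixes f :: "'t::metric_space \<Rightarrow> 'x::metric_space"
  assumes "\<And>s t. dist (f s) (f t) \<le> L * dist s t"
  shows "f \<in> Lip"
proof -
  have "(max L 0)-lipschitz_on UNIV f"
    by (auto simp: lipschitz_on_def intro!: order_trans[OF assms] mult_right_mono)
  then show ?thesis unfolding Lip_def by blast
qed

text \<open>Turns the supremum of difference quotients into an inequality that is closed in \<open>(s, t)\<close> and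
  does not exclude the diagonal. Two distinct points are required: for a supremum over the empty set the real
  \<open>lip_const f\<close> is unspecified.\<close>

lemma lip_const_le_iff:
  fixes f :: "'t::metric_space \<Rightarrow> 'x::metric_space"
  assumes two: "\<exists>s t :: 't. s \<noteq> t" and f: "f \<in> Lip"
  shows "lip_const f \<le> c \<longleftrightarrow> (\<forall>s t. dist (f s) (f t) \<le> c * dist s t)"
proof -
  obtain L where "L-lipschitz_on UNIV f" using f unfolding Lip_def by blast
  then have "bdd_above ((\<lambda>(s, t). dist (f s) (f t) / dist s t) ` {(s, t). s \<noteq> t})"
    unfolding lipschitz_on_def by (intro bdd_aboveI2[where M = L]) (auto simp: divide_le_eq)
  then have "lip_const f \<le> c \<longleftrightarrow> (\<forall>(s, t)\<in>{(s, t). s \<noteq> t}. dist (f s) (f t) / dist s t \<le> c)"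
    unfolding lip_const_def using two by (subst cSUP_le_iff) (auto simp: split_def)
  also have "\<dots> \<longleftrightarrow> (\<forall>s t. dist (f s) (f t) \<le> c * dist s t)"
    by (auto simp: divide_le_eq) (metis dist_self mult_zero_right order_refl)
  finally show ?thesis .
qed

lemma dist_le_lip_const:
  fixes f :: "'t::metric_space \<Rightarrow> 'x::metric_space"
  assumes "\<exists>s t :: 't. s \<noteq> t" and "f \<in> Lip"
  shows "dist (f s) (f t) \<le> lip_const f * dist s t"
  using lip_const_le_iff[OF assms] by blast

lemma lip_const_nonneg:
  fixes f :: "'t::metric_space \<Rightarrow> 'x::metric_space"
  assumes "\<exists>s t :: 't. s \<noteq> t" and "f \<in> Lip"
  shows "0 \<le> lip_const f"
proof -
  obtain s t :: 't where "s \<noteq> t" using assms(1) by blast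
  then show ?thesis
    using dist_le_lip_const[OF assms, of s t] zero_le_mult_iff[of "lip_const f" "dist s t"]
      order_trans[OF zero_le_dist] by fastforce
qed

lemma norm_le_sup_norm:
  fixes f :: "'t::metric_space \<Rightarrow> 'x::real_normed_vector"
  assumes comp: "compact (UNIV :: 't set)" and f: "continuous_on UNIV f"
  shows "norm (f t) \<le> sup_norm f"
proof -
  have "bounded (range f)"
    using comp f compact_continuous_image compact_imp_bounded by blast
  then have "bdd_above (range (\<lambda>t. norm (f t)))"
    unfolding bounded_iff bdd_above_def by auto
  then show ?thesis unfolding sup_norm_def by (intro cSUP_upper) auto
qed

text \<open>The distance is Borel on \<open>'t \<times> 't\<close>, while \<open>(u, v)\<close> is measurable for the product of the Borel
  \<open>\<sigma>\<close>-algebras. Instead of identifying the two, separability is used directly, by expressing \<open>dist a b \<le> c\<close> through the distances of \<open>a\<close> and of \<open>b\<close> to the points of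
  a countable dense set.\<close>

lemma measurable_dist_compact:
  fixes u v :: "'a \<Rightarrow> 't::metric_space"
  assumes comp: "compact (UNIV :: 't set)"
    and u: "u \<in> borel_measurable M" and v: "v \<in> borel_measurable M"
  shows "(\<lambda>\<theta>. dist (u \<theta>) (v \<theta>)) \<in> borel_measurable M"
proof -
  obtain D :: "'t set" where D: "countable D" "closure D = UNIV"
    using compact_UNIV_countable_dense[OF comp] by blast
  have dist_const: "(\<lambda>\<theta>. dist (w \<theta>) q) \<in> borel_measurable M" if "w \<in> borel_measurable M" for w :: "'a \<Rightarrow> 't" and q
    by (rule measurable_compose[OF that]) (intro borel_measurable_continuous_onI continuous_intros)
  note [measurable] = dist_const[OF u] dist_const[OF v]
  have eq: "dist a b \<le> c \<longleftrightarrow> (\<forall>q\<in>D. dist a q \<le> dist b q + c)" for a b :: 't and c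
  proof
    assume "dist a b \<le> c"
    then show "\<forall>q\<in>D. dist a q \<le> dist b q + c"
      using dist_triangle[of a _ b] by (auto intro!: order_trans[OF dist_triangle[of a _ b]])
  next
    assume *: "\<forall>q\<in>D. dist a q \<le> dist b q + c"
    \<comment> \<open>by density the inequality holds for all \<open>q\<close>, in particular for \<open>q = b\<close>\<close>
    have "closed {q. dist a q \<le> dist b q + c}"
      by (intro closed_Collect_le continuous_intros)
    then have "closure D \<subseteq> {q. dist a q \<le> dist b q + c}"
      using * by (intro closure_minimal) auto
    then have "b \<in> {q. dist a q \<le> dist b q + c}" unfolding D(2) by blast
    then show "dist a b \<le> c" by simp
  qed
  have "{\<theta> \<in> space M. \<forall>q\<in>D. dist (u \<theta>) q \<le> dist (v \<theta>) q + c} \<in> sets M" for c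
    by (intro sets.sets_Collect_countable_All' D(1)) measurable
  then show ?thesis
    unfolding borel_measurable_iff_le eq[symmetric] by blast
qed

text \<open>Since each \<open>\<phi> \<theta>\<close> is continuous, \<open>lip_const (\<phi> \<theta>) \<le> c\<close> has to be tested on a countable dense
  set of pairs only.\<close>

lemma lip_const_measurable:
  fixes \<phi> :: "'a \<Rightarrow> 't::metric_space \<Rightarrow> 't"
  assumes comp: "compact (UNIV :: 't set)" and two: "\<exists>s t :: 't. s \<noteq> t"
    and meas: "\<And>t. (\<lambda>\<theta>. \<phi> \<theta> t) \<in> borel_measurable M"
    and lip: "\<And>\<theta>. \<theta> \<in> space M \<Longrightarrow> \<phi> \<theta> \<in> Lip"
  shows "(\<lambda>\<theta>. lip_const (\<phi> \<theta>)) \<in> borel_measurable M"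
proof -
  obtain D :: "'t set" where D: "countable D" "closure D = UNIV"
    using compact_UNIV_countable_dense[OF comp] by blast
  note [measurable] = measurable_dist_compact[OF comp meas meas]
  have eq: "lip_const (\<phi> \<theta>) \<le> c \<longleftrightarrow> (\<forall>s\<in>D. \<forall>t\<in>D. dist (\<phi> \<theta> s) (\<phi> \<theta> t) \<le> c * dist s t)"
    if \<theta>: "\<theta> \<in> space M" for \<theta> c
  proof -
    let ?C = "{p. dist (\<phi> \<theta> (fst p)) (\<phi> \<theta> (snd p)) \<le> c * dist (fst p) (snd p)}"
    have "continuous_on UNIV (\<lambda>p. \<phi> \<theta> (g p))" if "continuous_on UNIV g" for g :: "'t \<times> 't \<Rightarrow> 't"
      using continuous_on_compose2[OF Lip_continuous_on[OF lip[OF \<theta>]] that] by simp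
    from this[OF continuous_on_fst[OF continuous_on_id]] this[OF continuous_on_snd[OF continuous_on_id]]
    have "closed ?C"
      by (intro closed_Collect_le continuous_intros)
    then have "closure (D \<times> D) \<subseteq> ?C" if "D \<times> D \<subseteq> ?C"
      using that by (rule closure_minimal[rotated])
    then have "(\<forall>s\<in>D. \<forall>t\<in>D. dist (\<phi> \<theta> s) (\<phi> \<theta> t) \<le> c * dist s t)
        \<longleftrightarrow> (\<forall>s t. dist (\<phi> \<theta> s) (\<phi> \<theta> t) \<le> c * dist s t)"
      unfolding closure_Times D(2) by fastforce
    then show ?thesis using lip_const_le_iff[OF two lip[OF \<theta>]] by simp
  qed
  have "{\<theta> \<in> space M. \<forall>s\<in>D. \<forall>t\<in>D. dist (\<phi> \<theta> s) (\<phi> \<theta> t) \<le> c * dist s t} \<in> sets M" for c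
    by (intro sets.sets_Collect_countable_All' D(1)) measurable
  then show ?thesis
    unfolding borel_measurable_iff_le by (simp add: eq cong: conj_cong)
qed


section \<open>The averaging operator\<close>

lemma continuous_linear_imp_bounded_linear:
  fixes T :: "'a::real_normed_vector \<Rightarrow> 'b::real_normed_vector"
  assumes T: "linear T" and cont: "continuous_on UNIV T"
  shows "bounded_linear T"
proof -
  interpret linear T by fact
  have "isCont T 0" using cont by (simp add: continuous_on_eq_continuous_at)
  then obtain d where d: "d > 0" "\<And>x. norm x < d \<Longrightarrow> norm (T x) < 1"
    unfolding continuous_at_eps_delta using zero by (auto simp: dist_norm dest!: spec[of _ 1])
  have "norm (T x) \<le> norm x * (2 / d)" for x
  proof (cases "x = 0")
    case False
    define r where "r = d / (2 * norm x)"
    have "r > 0" using False d(1) by (simp add: r_def)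
    have "norm (r *\<^sub>R x) < d" using False d(1) by (simp add: r_def)
    then have "r * norm (T x) < 1" using d(2) \<open>r > 0\<close> by (fastforce simp: scale)
    then show ?thesis using \<open>r > 0\<close> False d(1) by (simp add: r_def field_simps)
  qed (simp add: zero)
  then show ?thesis
    by (intro bounded_linear_intro[of T "2 / d"]) (auto simp: add scale)
qed

context hilbert_space
begin

text \<open>Conjugate symmetry moves the second factor \<open>c\<close> out of \<open>ip (c x) (c x)\<close>, which is computed inside \<open>\<complex>\<close>
  by means of \<open>rc_embed\<close>.\<close>

lemma norm_scale: "norm (scale c x) = norm c * norm x"
proof -
  have rc_of_real: "rc_embed (of_real r :: 'k) = of_real r" for r
    unfolding of_real_def[where 'a = 'k] by (rule rc_embed_scaleR)
  have "complex_of_real ((norm (scale c x))\<^sup>2) = rc_embed c * cnj (rc_embed (ip (scale c x) x))"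
    by (metis ip_self ip_scale_left ip_conj_sym rc_embed_mult rc_of_real)
  also have "\<dots> = rc_embed c * cnj (rc_embed c) * of_real ((norm x)\<^sup>2)"
    by (simp add: ip_scale_left ip_self rc_embed_mult rc_of_real del: of_real_power)
  finally have "norm (complex_of_real ((norm (scale c x))\<^sup>2)) = norm (\<dots>)"
    by (rule arg_cong)
  then have "(norm (scale c x))\<^sup>2 = (norm c * norm x)\<^sup>2"
    by (simp add: norm_mult norm_rc_embed power2_eq_square mult_ac)
  then show ?thesis by (simp add: power2_eq_iff_nonneg)
qed

lemma bounded_linear_scale: "bounded_linear (scale c)"
proof (rule bounded_linear_intro[of _ "norm c"])
  show "scale c (r *\<^sub>R x) = r *\<^sub>R scale c x" for r x
    by (simp add: mult.commute flip: scale_of_real)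
qed (simp_all add: scale_right_distrib norm_scale mult.commute)

lemma linear_imp_real_linear:
  assumes "Vector_Spaces.linear scale scale T"
  shows "linear T"
proof -
  interpret T: Vector_Spaces.linear scale scale T by fact
  show ?thesis
    by (rule linearI) (simp_all add: T.add T.scale flip: scale_of_real)
qed

end

text \<open>The estimates on \<open>H\<close> and its additivity concern the real Banach space underlying \<open>X\<close>. The scalars of the
  Hilbert space enter as operators commuting with every \<open>R\<^sub>\<theta>\<close>.\<close>

locale averaging =
  fixes W :: "'th measure"
    and \<omega> :: "'t::metric_space \<times> 'th \<Rightarrow> 't"
    and R :: "'x::banach \<times> 'th \<Rightarrow> 'x"
  assumes T_compact: "compact (UNIV :: 't set)"
    and T_nontrivial: "\<exists>s t :: 't. s \<noteq> t"
    and \<omega>_measurable: "\<omega> \<in> (borel \<Otimes>\<^sub>M W) \<rightarrow>\<^sub>M borel"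
    and R_measurable: "R \<in> (borel \<Otimes>\<^sub>M W) \<rightarrow>\<^sub>M borel"
    and R_bounded_linear: "\<And>\<theta>. \<theta> \<in> space W \<Longrightarrow> bounded_linear (\<lambda>x. R (x, \<theta>))"
    and \<omega>_Lipschitz: "\<And>\<theta>. \<theta> \<in> space W \<Longrightarrow> (\<lambda>t. \<omega> (t, \<theta>)) \<in> Lip"
    and R_norm_measurable: "(\<lambda>\<theta>. onorm (\<lambda>x. R (x, \<theta>))) \<in> borel_measurable W"
    and finite_integral:
      "(\<integral>\<^sup>+\<theta>. ennreal (onorm (\<lambda>x. R (x, \<theta>)) * (1 + lip_const (\<lambda>t. \<omega> (t, \<theta>)))) \<partial>W) < \<infinity>"
    and R_separably_valued: "\<And>x. ae_separably_valued W (\<lambda>\<theta>. R (x, \<theta>))"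
begin

abbreviation "R_norm \<theta> \<equiv> onorm (\<lambda>x. R (x, \<theta>))"
abbreviation "r \<theta> \<equiv> lip_const (\<lambda>t. \<omega> (t, \<theta>))"
abbreviation "H \<equiv> H_L W R \<omega>"

lemma R_norm_nonneg: "\<theta> \<in> space W \<Longrightarrow> 0 \<le> R_norm \<theta>"
  by (intro onorm_pos_le R_bounded_linear)

lemma r_nonneg: "\<theta> \<in> space W \<Longrightarrow> 0 \<le> r \<theta>"
  by (intro lip_const_nonneg T_nontrivial \<omega>_Lipschitz)

lemma norm_R_le: "\<theta> \<in> space W \<Longrightarrow> norm (R (x, \<theta>)) \<le> R_norm \<theta> * norm x"
  by (intro onorm R_bounded_linear)

lemma \<omega>_section_measurable: "(\<lambda>\<theta>. \<omega> (t, \<theta>)) \<in> borel_measurable W"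
  by (rule measurable_compose[OF _ \<omega>_measurable]) (intro measurable_Pair, auto)

lemma r_measurable: "r \<in> borel_measurable W"
  by (intro lip_const_measurable T_compact T_nontrivial \<omega>_section_measurable \<omega>_Lipschitz)

lemma integrable_R_norm_r: "integrable W (\<lambda>\<theta>. R_norm \<theta> * (1 + r \<theta>))"
proof (rule integrableI_nonneg)
  show "(\<lambda>\<theta>. R_norm \<theta> * (1 + r \<theta>)) \<in> borel_measurable W"
    using R_norm_measurable r_measurable by measurable
  show "AE \<theta> in W. 0 \<le> R_norm \<theta> * (1 + r \<theta>)"
    by (intro AE_I2) (simp add: R_norm_nonneg r_nonneg)
qed (use finite_integral in simp)

lemma integrable_R_norm: "integrable W R_norm"
  using R_norm_measurable
  by (rule Bochner_Integration.integrable_bound[OF integrable_R_norm_r])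
    (auto intro!: AE_I2 mult_right_le_one_le simp: R_norm_nonneg r_nonneg abs_mult algebra_simps)

lemma integrable_R_norm_times_r: "integrable W (\<lambda>\<theta>. R_norm \<theta> * r \<theta>)"
  using Bochner_Integration.integrable_diff[OF integrable_R_norm_r integrable_R_norm]
  by (simp add: algebra_simps)

lemma integrand_measurable:
  assumes f: "continuous_on UNIV f"
  shows "(\<lambda>\<theta>. R (f (\<omega> (t, \<theta>)), \<theta>)) \<in> borel_measurable W"
  using measurable_compose[OF \<omega>_section_measurable borel_measurable_continuous_onI[OF f]]
  by (intro measurable_compose[OF _ R_measurable] measurable_Pair) auto

text \<open>For a countable dense \<open>D\<close>, almost every \<open>\<theta>\<close> puts \<open>R (f d, \<theta>)\<close> into a fixed separable closed set for all
  \<open>d \<in> D\<close> simultaneously. For such \<open>\<theta>\<close>, continuity of \<open>t \<mapsto> R (f t, \<theta>)\<close> extends this to all points of \<open>T\<close>,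
  among them \<open>\<omega> (t, \<theta>)\<close>, which varies with \<open>\<theta>\<close>.\<close>

lemma integrand_separably_valued:
  assumes f: "continuous_on UNIV f"
  shows "ae_separably_valued W (\<lambda>\<theta>. R (f (\<omega> (t, \<theta>)), \<theta>))"
proof -
  obtain D :: "'t set" where D: "countable D" "closure D = UNIV"
    using compact_UNIV_countable_dense[OF T_compact] by blast
  obtain S where S: "\<And>x. countable (S x)" "\<And>x. AE \<theta> in W. R (x, \<theta>) \<in> closure (S x)"
    using R_separably_valued unfolding ae_separably_valued_def by metis
  define S' where "S' = (\<Union>d\<in>D. S (f d))"
  have "AE \<theta> in W. \<forall>d\<in>D. R (f d, \<theta>) \<in> closure (S (f d))"
    using D(1) S(2) by (simp add: AE_ball_countable)
  then have "AE \<theta> in W. R (f (\<omega> (t, \<theta>)), \<theta>) \<in> closure S'"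
    using AE_space
  proof eventually_elim
    case (elim \<theta>)
    have "continuous_on (closure D) (\<lambda>t. R (f t, \<theta>))"
      using bounded_linear.continuous_on[OF R_bounded_linear[OF elim(2)] f] D(2) by simp
    moreover have "(\<lambda>t. R (f t, \<theta>)) ` D \<subseteq> closure S'"
      using elim(1) closure_mono[of "S (f _)" S'] unfolding S'_def by blast
    ultimately have "(\<lambda>t. R (f t, \<theta>)) ` closure D \<subseteq> closure S'"
      by (intro image_closure_subset) auto
    then show ?case using D(2) by auto
  qed
  moreover have "countable S'" unfolding S'_def using D(1) S(1) by blast
  ultimately show ?thesis unfolding ae_separably_valued_def by blast
qed

lemma norm_integrand_le:
  assumes f: "continuous_on UNIV f" and \<theta>: "\<theta> \<in> space W"
  shows "norm (R (f (\<omega> (t, \<theta>)), \<theta>)) \<le> R_norm \<theta> * sup_norm f"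
  using norm_R_le[OF \<theta>] norm_le_sup_norm[OF T_compact f] R_norm_nonneg[OF \<theta>]
  by (meson mult_left_mono order_trans)

lemma integrand_integrable:
  assumes f: "continuous_on UNIV f"
  shows "bochner_integrable W (\<lambda>\<theta>. R (f (\<omega> (t, \<theta>)), \<theta>))"
proof (intro bochner_integrableI_ae_separably_valued integrand_measurable integrand_separably_valued f)
  have "(\<integral>\<^sup>+\<theta>. norm (R (f (\<omega> (t, \<theta>)), \<theta>)) \<partial>W) \<le> (\<integral>\<^sup>+\<theta>. norm (R_norm \<theta> * sup_norm f) \<partial>W)"
    by (intro nn_integral_mono ennreal_leI order_trans[OF norm_integrand_le[OF f]]) auto
  also have "\<dots> < \<infinity>"
    using integrable_mult_left[OF integrable_R_norm, of "sup_norm f"]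
    unfolding integrable_iff_bounded by auto
  finally show "(\<integral>\<^sup>+\<theta>. norm (R (f (\<omega> (t, \<theta>)), \<theta>)) \<partial>W) < \<infinity>" .
qed

lemma has_integral_H:
  assumes f: "continuous_on UNIV f"
  shows "has_bochner_integral_gen W (\<lambda>\<theta>. R (f (\<omega> (t, \<theta>)), \<theta>)) (H f t)"
  unfolding H_L_def by (intro has_bochner_integral_gen_bochner_integral integrand_integrable f)

lemma norm_H_le:
  assumes f: "continuous_on UNIV f"
  shows "norm (H f t) \<le> (\<integral>\<theta>. R_norm \<theta> \<partial>W) * sup_norm f"
  using has_bochner_integral_gen_dist_le[OF has_integral_H[OF f] has_bochner_integral_gen_zero
      integrable_mult_left[OF integrable_R_norm, of "sup_norm f"]] norm_integrand_le[OF f] integrable_R_norm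
  by simp

lemma dist_H_le:
  assumes f: "f \<in> Lip"
  shows "dist (H f s) (H f t) \<le> (\<integral>\<theta>. R_norm \<theta> * r \<theta> \<partial>W) * lip_const f * dist s t"
proof -
  note I = has_integral_H[OF Lip_continuous_on[OF f]]
  have "norm (R (f (\<omega> (s, \<theta>)), \<theta>) - R (f (\<omega> (t, \<theta>)), \<theta>)) \<le> R_norm \<theta> * r \<theta> * (lip_const f * dist s t)"
    if \<theta>: "\<theta> \<in> space W" for \<theta>
  proof -
    interpret R: bounded_linear "\<lambda>x. R (x, \<theta>)" by (rule R_bounded_linear[OF \<theta>])
    have "dist (f (\<omega> (s, \<theta>))) (f (\<omega> (t, \<theta>))) \<le> lip_const f * dist (\<omega> (s, \<theta>)) (\<omega> (t, \<theta>))"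
      by (rule dist_le_lip_const[OF T_nontrivial f])
    also have "\<dots> \<le> lip_const f * (r \<theta> * dist s t)"
      by (intro mult_left_mono dist_le_lip_const[OF T_nontrivial \<omega>_Lipschitz[OF \<theta>]]
          lip_const_nonneg[OF T_nontrivial f])
    finally have "R_norm \<theta> * norm (f (\<omega> (s, \<theta>)) - f (\<omega> (t, \<theta>))) \<le> R_norm \<theta> * (lip_const f * (r \<theta> * dist s t))"
      unfolding dist_norm by (intro mult_left_mono R_norm_nonneg[OF \<theta>])
    then show ?thesis
      using norm_R_le[OF \<theta>, of "f (\<omega> (s, \<theta>)) - f (\<omega> (t, \<theta>))"] by (simp add: R.diff mult_ac)
  qed
  from has_bochner_integral_gen_dist_le[OF I I
      integrable_mult_left[OF integrable_R_norm_times_r, of "lip_const f * dist s t"] this]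
  show ?thesis using integrable_R_norm_times_r by (simp add: dist_norm mult_ac)
qed

lemma H_Lip: "f \<in> Lip \<Longrightarrow> H f \<in> Lip"
  using dist_H_le by (rule LipI)

lemma H_add:
  assumes f: "continuous_on UNIV f" and g: "continuous_on UNIV g"
  shows "H (\<lambda>t. f t + g t) = (\<lambda>t. H f t + H g t)"
proof
  fix t
  have fg: "continuous_on UNIV (\<lambda>t. f t + g t)" using f g by (intro continuous_intros)
  have eq: "R (f (\<omega> (t, \<theta>)) + g (\<omega> (t, \<theta>)), \<theta>) = R (f (\<omega> (t, \<theta>)), \<theta>) + R (g (\<omega> (t, \<theta>)), \<theta>)"
    if "\<theta> \<in> space W" for \<theta>
    using linear_add[OF bounded_linear.linear[OF R_bounded_linear[OF that]]] .
  \<comment> \<open>the sum is measurable because it is the integrand belonging to the continuous function \<open>f + g\<close>\<close>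
  have "(\<lambda>\<theta>. R (f (\<omega> (t, \<theta>)), \<theta>) + R (g (\<omega> (t, \<theta>)), \<theta>)) \<in> borel_measurable W"
    using integrand_measurable[OF fg, of t] by (rule iffD1[OF measurable_cong, rotated]) (rule eq)
  from has_bochner_integral_gen_add[OF has_integral_H[OF f] has_integral_H[OF g] this]
  have "has_bochner_integral_gen W (\<lambda>\<theta>. R (f (\<omega> (t, \<theta>)) + g (\<omega> (t, \<theta>)), \<theta>)) (H f t + H g t)"
    by (rule iffD2[OF has_bochner_integral_gen_cong, rotated]) (rule eq)
  then show "H (\<lambda>t. f t + g t) t = H f t + H g t"
    unfolding H_L_def[of W R \<omega> "\<lambda>t. f t + g t"] by (rule bochner_integral_eqI)
qed

text \<open>Stated for any bounded operator \<open>A\<close> commuting with all \<open>R\<^sub>\<theta>\<close>; the case of interest is multiplication by a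
  scalar.\<close>

lemma H_commute:
  assumes A: "bounded_linear A" and comm: "\<And>\<theta> x. \<theta> \<in> space W \<Longrightarrow> R (A x, \<theta>) = A (R (x, \<theta>))"
    and f: "continuous_on UNIV f"
  shows "H (\<lambda>t. A (f t)) = (\<lambda>t. A (H f t))"
proof
  fix t
  have "has_bochner_integral_gen W (\<lambda>\<theta>. R (A (f (\<omega> (t, \<theta>))), \<theta>)) (A (H f t))"
    using has_bochner_integral_gen_bounded_linear[OF has_integral_H[OF f, of t] A]
    by (subst has_bochner_integral_gen_cong[where g = "\<lambda>\<theta>. A (R (f (\<omega> (t, \<theta>)), \<theta>))"])
      (simp_all only: comm)
  then show "H (\<lambda>t. A (f t)) t = A (H f t)"
    unfolding H_L_def[of W R \<omega> "\<lambda>t. A (f t)"] by (rule bochner_integral_eqI)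
qed

lemma BL_norm_H_le:
  assumes f: "f \<in> Lip"
  shows "BL_norm (H f) \<le> (\<integral>\<theta>. R_norm \<theta> * (1 + r \<theta>) \<partial>W) * BL_norm f"
proof -
  let ?A = "\<integral>\<theta>. R_norm \<theta> \<partial>W" and ?B = "\<integral>\<theta>. R_norm \<theta> * r \<theta> \<partial>W"
  have AB: "0 \<le> ?A" "0 \<le> ?B"
    by (auto intro!: integral_nonneg_AE AE_I2 simp: R_norm_nonneg r_nonneg)
  have f0: "0 \<le> sup_norm f" "0 \<le> lip_const f"
    using norm_le_sup_norm[OF T_compact Lip_continuous_on[OF f]] norm_ge_zero order_trans
      lip_const_nonneg[OF T_nontrivial f] by blast+
  have "sup_norm (H f) \<le> ?A * sup_norm f"
    unfolding sup_norm_def[of "H f"]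
    by (intro cSUP_least norm_H_le Lip_continuous_on f) simp
  moreover have "lip_const (H f) \<le> ?B * lip_const f"
    using dist_H_le[OF f] lip_const_le_iff[OF T_nontrivial H_Lip[OF f]] by blast
  ultimately have "BL_norm (H f) \<le> ?A * sup_norm f + ?B * lip_const f"
    unfolding BL_norm_def by linarith
  also have "\<dots> \<le> (?A + ?B) * BL_norm f"
    using AB f0 unfolding BL_norm_def by (simp add: algebra_simps)
  also have "?A + ?B = (\<integral>\<theta>. R_norm \<theta> * (1 + r \<theta>) \<partial>W)"
    using Bochner_Integration.integral_add[OF integrable_R_norm integrable_R_norm_times_r]
    by (simp add: algebra_simps)
  finally show ?thesis .
qed

lemma bound_nonneg: "0 \<le> (\<integral>\<theta>. R_norm \<theta> * (1 + r \<theta>) \<partial>W)"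
  by (intro integral_nonneg_AE AE_I2) (simp add: R_norm_nonneg r_nonneg)

lemma BL_dist_H_le:
  assumes f: "f \<in> Lip" and g: "g \<in> Lip"
  shows "BL_dist (H f) (H g) \<le> (\<integral>\<theta>. R_norm \<theta> * (1 + r \<theta>) \<partial>W) * BL_dist f g"
proof -
  have d: "(\<lambda>t. f t - g t) \<in> Lip" using f g by (rule Lip_diff)
  have "H f = (\<lambda>t. H (\<lambda>t. f t - g t) t + H g t)"
    using H_add[OF Lip_continuous_on[OF d] Lip_continuous_on[OF g]] by simp
  then have "(\<lambda>t. H f t - H g t) = H (\<lambda>t. f t - g t)" by simp
  then show ?thesis
    using BL_norm_H_le[OF d] f g by (simp add: BL_dist_def H_Lip)
qed

lemma H_continuous: "continuous_map BL_topology BL_topology H"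
proof -
  let ?C = "\<integral>\<theta>. R_norm \<theta> * (1 + r \<theta>) \<partial>W"
  interpret BL: Metric_space "Lip :: ('t \<Rightarrow> 'x) set" BL_dist
    by (rule Metric_space_BL_dist[OF T_compact T_nontrivial])
  have "\<exists>\<delta>>0. \<forall>g. g \<in> Lip \<and> BL_dist f g < \<delta> \<longrightarrow> BL_dist (H f) (H g) < \<epsilon>"
    if f: "f \<in> Lip" and "\<epsilon> > 0" for f \<epsilon>
  \<comment> \<open>\<open>?C\<close> may vanish, hence the division by \<open>?C + 1\<close>\<close>
  proof (intro exI[of _ "\<epsilon> / (?C + 1)"] conjI allI impI)
    show "0 < \<epsilon> / (?C + 1)" using \<open>\<epsilon> > 0\<close> bound_nonneg by simp
    fix g assume g: "g \<in> Lip \<and> BL_dist f g < \<epsilon> / (?C + 1)"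
    have "BL_dist (H f) (H g) \<le> ?C * BL_dist f g" using BL_dist_H_le f g by blast
    also have "\<dots> \<le> (?C + 1) * BL_dist f g" by (simp add: algebra_simps)
    also have "\<dots> < \<epsilon>" using g bound_nonneg by (simp add: field_simps)
    finally show "BL_dist (H f) (H g) < \<epsilon>" .
  qed
  then show ?thesis
    unfolding BL_topology_def using H_Lip
    by (subst BL.metric_continuous_map[OF BL.Metric_space_axioms]) auto
qed

lemma BL_onorm_H_le: "BL_onorm H \<le> (\<integral>\<theta>. R_norm \<theta> * (1 + r \<theta>) \<partial>W)"
  unfolding BL_onorm_def
proof (rule cSUP_least)
  have "(\<lambda>_. 0 :: 'x) \<in> (Lip :: ('t \<Rightarrow> 'x) set)" by (rule LipI[of _ 0]) simp
  moreover have "BL_norm (\<lambda>_ :: 't. 0 :: 'x) = 0"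
    using T_nontrivial by (auto simp: BL_norm_def sup_norm_def lip_const_def split_def)
  ultimately show "{f :: 't \<Rightarrow> 'x. f \<in> Lip \<and> BL_norm f \<le> 1} \<noteq> {}"
    by (metis (mono_tags, lifting) empty_Collect_eq zero_le_one)
next
  fix f :: "'t \<Rightarrow> 'x" assume "f \<in> {f \<in> Lip. BL_norm f \<le> 1}"
  then show "BL_norm (H f) \<le> (\<integral>\<theta>. R_norm \<theta> * (1 + r \<theta>) \<partial>W)"
    using BL_norm_H_le[of f] mult_left_mono[of "BL_norm f" 1, OF _ bound_nonneg] by simp
qed

end

theorem theorem4p2:
  fixes W :: "'th measure"
    and scale :: "'k::real_or_complex \<Rightarrow> 'x::banach \<Rightarrow> 'x"
    and ip :: "'x \<Rightarrow> 'x \<Rightarrow> 'k"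
    and \<omega> :: "'t::metric_space \<times> 'th \<Rightarrow> 't"
    and R :: "'x \<times> 'th \<Rightarrow> 'x"
  assumes T_compact: "compact (UNIV :: 't set)"
    and T_nontrivial: "\<exists>s t :: 't. s \<noteq> t"
    and X_hilbert: "hilbert_space scale ip"
    and X_nonnull: "\<exists>x :: 'x. x \<noteq> 0"
    and \<omega>_measurable: "\<omega> \<in> (borel \<Otimes>\<^sub>M W) \<rightarrow>\<^sub>M borel"
    and R_measurable: "R \<in> (borel \<Otimes>\<^sub>M W) \<rightarrow>\<^sub>M borel"
    and R_linear: "\<And>\<theta>. \<theta> \<in> space W \<Longrightarrow> Vector_Spaces.linear scale scale (\<lambda>x. R (x, \<theta>))"
    and R_continuous: "\<And>\<theta>. \<theta> \<in> space W \<Longrightarrow> continuous_on UNIV (\<lambda>x. R (x, \<theta>))"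
    and \<omega>_Lipschitz: "\<And>\<theta>. \<theta> \<in> space W \<Longrightarrow> (\<lambda>t. \<omega> (t, \<theta>)) \<in> Lip"
    and R_norm_measurable: "(\<lambda>\<theta>. onorm (\<lambda>x. R (x, \<theta>))) \<in> borel_measurable W"
    and finite_integral:
      "(\<integral>\<^sup>+\<theta>. ennreal (onorm (\<lambda>x. R (x, \<theta>)) * (1 + lip_const (\<lambda>t. \<omega> (t, \<theta>)))) \<partial>W) < \<infinity>"
    \<comment> \<open>strong measurability; automatic for separable \<open>X\<close>\<close>
    and R_separably_valued: "\<And>x. ae_separably_valued W (\<lambda>\<theta>. R (x, \<theta>))"
  shows
    \<comment> \<open>the integral defining \<open>H_L\<close> exists as a Bochner integral\<close>
    "(\<forall>f t. continuous_on UNIV f \<longrightarrow> bochner_integrable W (\<lambda>\<theta>. R (f (\<omega> (t, \<theta>)), \<theta>))) \<and>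
     \<comment> \<open>\<open>H_L\<close> is a linear operator on \<open>Lip\<close>\<close>
     (\<forall>f\<in>Lip. H_L W R \<omega> f \<in> Lip) \<and>
     (\<forall>f\<in>Lip. \<forall>g\<in>Lip. H_L W R \<omega> (\<lambda>t. f t + g t) = (\<lambda>t. H_L W R \<omega> f t + H_L W R \<omega> g t)) \<and>
     (\<forall>c. \<forall>f\<in>Lip. H_L W R \<omega> (\<lambda>t. scale c (f t)) = (\<lambda>t. scale c (H_L W R \<omega> f t))) \<and>
     continuous_map BL_topology BL_topology (H_L W R \<omega>) \<and>
     BL_onorm (H_L W R \<omega>)
       \<le> (\<integral>\<theta>. onorm (\<lambda>x. R (x, \<theta>)) * (1 + lip_const (\<lambda>t. \<omega> (t, \<theta>))) \<partial>W)"
proof -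
  interpret X: hilbert_space scale ip by (rule X_hilbert)
  interpret averaging W \<omega> R
  proof (rule averaging.intro)
    show "bounded_linear (\<lambda>x. R (x, \<theta>))" if "\<theta> \<in> space W" for \<theta>
      using that by (intro continuous_linear_imp_bounded_linear X.linear_imp_real_linear R_linear R_continuous)
  qed (fact T_compact T_nontrivial \<omega>_measurable R_measurable \<omega>_Lipschitz R_norm_measurable
      finite_integral R_separably_valued)+
  have R_scale: "R (scale c x, \<theta>) = scale c (R (x, \<theta>))" if "\<theta> \<in> space W" for c x \<theta>
  proof -
    interpret T: Vector_Spaces.linear scale scale "\<lambda>x. R (x, \<theta>)" by (rule R_linear[OF that])
    show ?thesis by (rule T.scale)
  qed
  show ?thesis
    by (intro conjI allI ballI impI integrand_integrable H_Lip H_add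
        H_commute[OF X.bounded_linear_scale] R_scale H_continuous BL_onorm_H_le)
      (simp_all add: Lip_continuous_on)
qed

end
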